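(* Let $p$ be an odd prime, $g$ a primitive root modulo $p$, $k$ a positive divisor of $p-1$, $d=(p-1)/k$, $e_p(x)=e^{2\pi i x/p}$, $\eta_a=\sum_{j=0}^{k-1}e_p(g^{dj+a})$, and $V_4(p)=\sum_{s=0}^{d-1}|\eta_s|^4$. Suppose $(p,k)$ is circular. (a) If $2\mid k$, then $V_4(p)=3p(k-1)-k^3$. (b) If $2\nmid k$ and $(p,2k)$ is also circular, then $V_4(p)=p(2k-1)-k^3$.
   Context: For a positive integer $k$, the pair $(p,k)$ is called circular if $k\mid(p-1)$ and, with $\Phi$ the subgroup of $\mathbb{F}_p^\times$ of order $k$, one has $|(\Phi a+b)\cap(\Phi c+e)|\le2$ for all $a,c\in\mathbb{F}_p^\times$ and $b,e\in\mathbb{F}_p$ with $\Phi a\neq\Phi c$ or $b\neq e$. *)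

theory Defs
  imports Complex_Main "HOL-Number_Theory.Number_Theory"
begin

text \<open>The field with \<open>p\<close> elements is \<^term>\<open>residue_ring (int p)\<close>, with carrier \<open>{0..p-1}\<close>;
  its multiplicative group is \<^term>\<open>units_of (residue_ring (int p))\<close>. For prime \<open>p\<close>, and \<open>k\<close> a
  divisor of \<open>p - 1\<close>, the latter has exactly one subgroup of order \<open>k\<close> (proved below as
  \<open>ex1_subgroup_of_card\<close>), so the quantifier over \<open>\<Phi>\<close> ranges over a single set. The sets
  \<open>\<Phi> a + b\<close> are formed in the field: \<open>#>\<close> is multiplication of a set by an element, and \<open>+>\<close>
  is translation of a set by an element.\<close>

definition circular :: "nat \<Rightarrow> nat \<Rightarrow> bool" where
  "circular p k \<longleftrightarrow> k > 0 \<and> k dvd p - 1 \<and>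
    (let F = residue_ring (int p) in
     \<forall>\<Phi>. subgroup \<Phi> (units_of F) \<and> card \<Phi> = k \<longrightarrow>
       (\<forall>a\<in>Units F. \<forall>c\<in>Units F. \<forall>b\<in>carrier F. \<forall>e\<in>carrier F.
          \<Phi> #>\<^bsub>F\<^esub> a \<noteq> \<Phi> #>\<^bsub>F\<^esub> c \<or> b \<noteq> e \<longrightarrow>
          card (((\<Phi> #>\<^bsub>F\<^esub> a) +>\<^bsub>F\<^esub> b) \<inter> ((\<Phi> #>\<^bsub>F\<^esub> c) +>\<^bsub>F\<^esub> e)) \<le> 2))"

lemma ex1_subgroup_of_card:
  fixes p k :: nat
  assumes p: "prime p" and k: "k > 0" "k dvd p - 1"
  shows "\<exists>!\<Phi>. subgroup \<Phi> (units_of (residue_ring (int p))) \<and> card \<Phi> = k"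
proof -
  define R where "R = residue_ring (int p)"
  interpret residues_prime p R
    by (rule residues_prime.intro) (use p R_def in auto)
  have p1: "p > 1" using p by (rule prime_gt_1_nat)
  let ?G = "units_of R"
  interpret G: group ?G by (rule units_group)
  have cG: "carrier ?G = carrier R - {\<zero>\<^bsub>R\<^esub>}"
    by (simp add: units_of_carrier field_Units)
  have finG: "finite (carrier ?G)" by (simp add: units_of_carrier)
  have cardG: "card (carrier ?G) = p - 1"
    using p1 by (simp add: units_of_carrier res_prime_units_eq)
  have pow: "x [^]\<^bsub>?G\<^esub> n = x [^]\<^bsub>R\<^esub> n" for x and n :: nat
    by (simp add: nat_pow_def units_of_def)
  have one: "\<one>\<^bsub>?G\<^esub> = \<one>\<^bsub>R\<^esub>" by (simp add: units_of_one)
  obtain g where g: "g \<in> carrier ?G"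
      and gen: "carrier ?G = {g [^]\<^bsub>?G\<^esub> i | i::nat. i \<in> UNIV}"
    using finite_field_mult_group_has_gen[OF finite] unfolding mult_of_is_Units pow by blast
  have "generate ?G {g} = carrier ?G"
    using G.generate_pow_on_finite_carrier[OF finG g] gen by simp
  hence ordg: "G.ord g = p - 1"
    using G.generate_pow_card[OF g] cardG by simp
  define d where "d = (p - 1) div k"
  have dk: "d * k = p - 1" using k by (simp add: d_def)
  hence dpos: "d \<noteq> 0" using p1 by (cases d) auto
  let ?h = "g [^]\<^bsub>?G\<^esub> d"
  have h: "?h \<in> carrier ?G" using g by simp
  have "d dvd G.ord g" unfolding ordg dk[symmetric] by simp
  hence "G.ord ?h = G.ord g div d" using G.ord_pow[OF g _ dpos] by simp
  hence "G.ord ?h = k" unfolding ordg dk[symmetric] using dpos by simp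
  hence ex1: "card (generate ?G {?h}) = k" using G.generate_pow_card[OF h] by simp
  have ex2: "subgroup (generate ?G {?h}) ?G"
    using G.generate_is_subgroup[of "{?h}"] h by simp
  let ?S = "{x \<in> carrier R. x [^]\<^bsub>R\<^esub> k = \<one>\<^bsub>R\<^esub>}"
  have S: "card ?S \<le> k" "finite ?S"
    using num_roots_le_deg[OF finite, of k] k by auto
  have uniq: "H = ?S" if H: "subgroup H ?G" "card H = k" for H
  proof (rule card_seteq)
    show "H \<subseteq> ?S"
    proof
      fix x assume x: "x \<in> H"
      interpret H: group "?G\<lparr>carrier := H\<rparr>" using H(1) G.is_group by (rule subgroup.subgroup_is_group)
      have "x [^]\<^bsub>?G\<lparr>carrier := H\<rparr>\<^esub> order (?G\<lparr>carrier := H\<rparr>) = \<one>\<^bsub>?G\<lparr>carrier := H\<rparr>\<^esub>"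
        using H.pow_order_eq_1[of x] x by simp
      hence "x [^]\<^bsub>?G\<^esub> k = \<one>\<^bsub>?G\<^esub>"
        using H(2) by (simp add: order_def nat_pow_def)
      moreover have "x \<in> carrier ?G" using H(1) x by (rule subgroup.mem_carrier)
      ultimately show "x \<in> ?S" by (simp add: pow one cG)
    qed
  qed (use S H in auto)
  have "H = generate ?G {?h}" if "subgroup H ?G" "card H = k" for H
    using uniq[OF that] uniq[OF ex2 ex1] by (rule trans[OF _ sym])
  with ex1 ex2 show ?thesis unfolding R_def[symmetric] by (intro ex1I[of _ "generate ?G {?h}"]) blast+
qed

definition e_p :: "nat \<Rightarrow> int \<Rightarrow> complex" where
  "e_p p x = exp (2 * of_real pi * \<i> * of_int x / of_nat p)"

definition eta :: "nat \<Rightarrow> nat \<Rightarrow> nat \<Rightarrow> nat \<Rightarrow> complex" where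
  "eta p g k a = (let d = (p - 1) div k in \<Sum>j<k. e_p p (int g ^ (d * j + a)))"

definition V4 :: "nat \<Rightarrow> nat \<Rightarrow> nat \<Rightarrow> real" where
  "V4 p g k = (let d = (p - 1) div k in \<Sum>s<d. cmod (eta p g k s) ^ 4)"

end

theory Submission
  imports Defs
begin

text \<open>Let \<open>\<Phi>\<close> be the group of \<open>k\<close>-th roots of unity modulo \<open>p\<close>. Orthogonality of the additive
  characters expresses \<open>k\<^sup>4 + k V\<^sub>4(p)\<close> as \<open>p\<close> times the additive energy of \<open>\<Phi>\<close>, the sum over
  \<open>(a, b) \<in> \<Phi> \<times> \<Phi>\<close> of the number \<open>r(a, b)\<close> of representations of \<open>a - b\<close> as a difference in \<open>\<Phi>\<close>.
  Circularity gives \<open>r \<le> 2\<close> off the diagonal. If \<open>- 1 \<in> \<Phi>\<close>, the involution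
  \<open>(c, e) \<mapsto> (- e, - c)\<close> on the representations forces \<open>r = 2\<close> unless \<open>b = - a\<close>, where \<open>r = 1\<close>.
  If \<open>- 1 \<notin> \<Phi>\<close>, the same involution on \<open>\<Phi> \<union> - \<Phi>\<close> and circularity of \<open>(p, 2k)\<close> force \<open>r = 1\<close>.\<close>

section \<open>The group of k-th roots of unity modulo p\<close>

definition unity_roots :: "nat \<Rightarrow> nat \<Rightarrow> int set" where
  "unity_roots p k = {x \<in> {1..<int p}. [x ^ k = 1] (mod int p)}"

lemma finite_unity_roots [simp]: "finite (unity_roots p k)"
  by (rule finite_subset[of _ "{1..<int p}"]) (auto simp: unity_roots_def)

lemma cong_unity_roots_eq:
  assumes "x \<in> unity_roots p k" "y \<in> unity_roots p k" "[x = y] (mod int p)"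
  shows "x = y"
  using assms by (auto simp: unity_roots_def cong_def)

text \<open>Roots are stored as representatives between 1 and p - 1, so that congruent roots are
  equal and can be counted. Reduction puts any integer root into this form: a multiple of p would
  have k-th power 0 rather than 1.\<close>

lemma mod_mem_unity_roots:
  assumes "prime p" "k > 0" "[x ^ k = 1] (mod int p)"
  shows "x mod int p \<in> unity_roots p k"
proof -
  have p: "int p > 1" using prime_gt_1_nat[OF assms(1)] by simp
  have "\<not> int p dvd x"
  proof
    assume "int p dvd x"
    hence "int p dvd x ^ k" by (rule dvd_trans[OF _ dvd_power]) (use assms(2) in simp)
    hence "[x ^ k = 0] (mod int p)" by (simp add: cong_0_iff)
    hence "[1 = 0] (mod int p)" using assms(3) cong_trans cong_sym by blast
    thus False using p by (simp add: cong_def)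
  qed
  hence "x mod int p \<noteq> 0" by (simp add: dvd_eq_mod_eq_0)
  moreover have "x mod int p \<ge> 0" "x mod int p < int p" using p by auto
  moreover have "[(x mod int p) ^ k = 1] (mod int p)" using assms(3) by (simp add: cong_def power_mod)
  ultimately show ?thesis by (simp add: unity_roots_def)
qed

lemma primroot_power_mod_bij:
  assumes "prime p" "residue_primroot p g"
  shows "bij_betw (\<lambda>n. int g ^ n mod int p) {..<p - 1} {1..<int p}"
proof -
  have p: "p > 1" using prime_gt_1_nat[OF assms(1)] .
  have "bij_betw (\<lambda>n. g ^ n mod p) {..<totient p} (totatives p)"
    using residue_primroot_is_generator[OF p assms(2)] .
  moreover have "bij_betw int (totatives p) {1..<int p}"
  proof -
    have "totatives p = {1..<p}" by (subst totatives_prime[OF assms(1)]) auto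
    thus ?thesis
      by (auto simp: bij_betw_def image_int_atLeastLessThan)
  qed
  ultimately have "bij_betw (int \<circ> (\<lambda>n. g ^ n mod p)) {..<totient p} {1..<int p}"
    by (rule bij_betw_trans)
  thus ?thesis using totient_prime[OF assms(1)] by (simp add: o_def zmod_int)
qed

lemma primroot_power_cong_1_iff:
  assumes "prime p" "residue_primroot p g"
  shows "[int g ^ n = 1] (mod int p) \<longleftrightarrow> (p - 1) dvd n"
proof -
  have "ord p g = p - 1"
    using assms totient_prime by (auto simp: residue_primroot_def)
  moreover have "[int g ^ n = 1] (mod int p) \<longleftrightarrow> [g ^ n = 1] (mod p)"
    by (metis cong_int_iff of_nat_1 of_nat_power)
  ultimately show ?thesis by (metis ord_divides)
qed

text \<open>Since g has order p - 1 = d k, the power g^n is a k-th root of unity iff d k divides n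
  k, that is, iff d divides n. The exponents d j are those occurring in \<open>eta\<close>.\<close>

lemma unity_roots_bij:
  assumes "prime p" "residue_primroot p g" "k > 0" "p - 1 = d * k"
  shows "bij_betw (\<lambda>j. int g ^ (d * j) mod int p) {..<k} (unity_roots p k)"
proof -
  let ?f = "\<lambda>n. int g ^ n mod int p"
  have bij: "bij_betw ?f {..<p - 1} {1..<int p}" using primroot_power_mod_bij[OF assms(1,2)] .
  have d: "d > 0" using assms(4) prime_gt_1_nat[OF assms(1)] by (cases d) auto
  have eq: "unity_roots p k = ?f ` ((\<lambda>j. d * j) ` {..<k})"
  proof (intro equalityI subsetI)
    fix x assume x: "x \<in> unity_roots p k"
    obtain n where n: "n < p - 1" "x = ?f n"
      proof -
      have "x \<in> ?f ` {..<p - 1}" using bij x by (simp add: unity_roots_def bij_betw_def)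
      thus ?thesis using that by blast
    qed
    have "[int g ^ (n * k) = 1] (mod int p)"
      using x n(2) by (simp add: unity_roots_def cong_def power_mod power_mult)
    hence "d * k dvd n * k" using primroot_power_cong_1_iff[OF assms(1,2)] assms(4) by simp
    hence "d dvd n" using assms(3) by simp
    then obtain j where "n = d * j" by auto
    with n d assms(4) show "x \<in> ?f ` ((\<lambda>j. d * j) ` {..<k})" by auto
  next
    fix x assume "x \<in> ?f ` ((\<lambda>j. d * j) ` {..<k})"
    then obtain j where j: "x = ?f (d * j)" by auto
    have "[int g ^ (d * j * k) = 1] (mod int p)"
      using primroot_power_cong_1_iff[OF assms(1,2)] assms(4) by simp
    thus "x \<in> unity_roots p k"
      unfolding j by (intro mod_mem_unity_roots assms) (simp add: power_mult)
  qed
  have "inj_on ?f ((\<lambda>j. d * j) ` {..<k})"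
    using bij d assms(4) by (elim bij_betw_imp_inj_on[THEN inj_on_subset]) auto
  moreover have "inj_on (\<lambda>j. d * j) {..<k}" using d by (auto simp: inj_on_def)
  ultimately have "inj_on (?f \<circ> (\<lambda>j. d * j)) {..<k}" by (rule comp_inj_on[rotated])
  thus ?thesis unfolding eq by (simp add: bij_betw_def o_def image_image)
qed

lemma card_unity_roots:
  assumes "prime p" "k > 0" "k dvd p - 1"
  shows "card (unity_roots p k) = k"
proof -
  obtain g where g: "residue_primroot p g"
    using assms(1) prime_primitive_root_exists prime_gt_1_nat by blast
  obtain d where "p - 1 = d * k" using assms(3) by (metis dvdE mult.commute)
  from unity_roots_bij[OF assms(1) g assms(2) this] show ?thesis
    by (metis bij_betw_same_card card_lessThan)
qed

text \<open>Together with \<open>card_unity_roots\<close> this allows the quantifier over subgroups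
  in \<open>circular\<close> to be instantiated with \<open>unity_roots p k\<close>.\<close>

lemma subgroup_unity_roots:
  assumes "prime p" "k > 0"
  shows "subgroup (unity_roots p k) (units_of (residue_ring (int p)))"
proof -
  define R where "R = residue_ring (int p)"
  interpret residues_prime p R
    by (rule residues_prime.intro) (use assms R_def in auto)
  interpret G: group "units_of R" by (rule units_group)
  have one: "1 \<in> unity_roots p k" using prime_gt_1_nat[OF assms(1)] by (simp add: unity_roots_def)
  have sub: "unity_roots p k \<subseteq> carrier (units_of R)"
    by (auto simp: units_of_carrier res_prime_units_eq unity_roots_def)
  have mult: "x \<otimes>\<^bsub>units_of R\<^esub> y = x * y mod int p" for x y
    by (simp add: units_of_mult res_mult_eq)
  have closed: "x \<otimes>\<^bsub>units_of R\<^esub> y \<in> unity_roots p k"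
    if "x \<in> unity_roots p k" "y \<in> unity_roots p k" for x y
  proof -
    have "[(x * y) ^ k = 1 * 1] (mod int p)"
      unfolding power_mult_distrib using that by (intro cong_mult) (auto simp: unity_roots_def)
    thus ?thesis unfolding mult by (intro mod_mem_unity_roots assms) simp
  qed
  have inv: "inv\<^bsub>units_of R\<^esub> x \<in> unity_roots p k" if x: "x \<in> unity_roots p k" for x
  proof -
    let ?y = "inv\<^bsub>units_of R\<^esub> x"
    have "?y \<in> carrier (units_of R)" using sub x by (intro G.inv_closed) auto
    hence y: "?y \<in> {1..<int p}" by (auto simp: units_of_carrier res_prime_units_eq)
    have "x \<otimes>\<^bsub>units_of R\<^esub> ?y = \<one>\<^bsub>units_of R\<^esub>" using sub x by (intro G.r_inv) auto
    hence "[x * ?y = 1] (mod int p)"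
      using m_gt_one by (simp add: mult units_of_one res_one_eq cong_def)
    \<comment> \<open>As x^k = 1, the power (x y)^k reduces to y^k, so the inverse y is a root as
      well.\<close>
    hence "[(x * ?y) ^ k = 1 ^ k] (mod int p)" by (rule cong_pow)
    moreover have "[x ^ k * ?y ^ k = 1 * ?y ^ k] (mod int p)"
      using x by (intro cong_mult) (auto simp: unity_roots_def)
    ultimately have "[?y ^ k = 1] (mod int p)"
      by (metis cong_sym cong_trans mult_1 power_mult_distrib power_one)
    thus ?thesis using y by (simp add: unity_roots_def)
  qed
  have "subgroup (unity_roots p k) (units_of R)"
    using sub one inv closed by (intro G.subgroupI) auto
  thus ?thesis by (simp add: R_def)
qed

section \<open>Circularity and representations of a difference\<close>

text \<open>Circularity is applied to the group itself and its translate by t, which is nonzero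
  modulo p; x, y, z would be three distinct common points. Arbitrary integers are allowed, so that
  negatives of roots can be supplied without reduction.\<close>

lemma circular_no_three_representations:
  assumes "prime p" and circ: "circular p k"
    and roots: "[x ^ k = 1] (mod int p)" "[y ^ k = 1] (mod int p)" "[z ^ k = 1] (mod int p)"
      "[x' ^ k = 1] (mod int p)" "[y' ^ k = 1] (mod int p)" "[z' ^ k = 1] (mod int p)"
    and differ: "\<not> [x = y] (mod int p)" "\<not> [x = z] (mod int p)" "\<not> [y = z] (mod int p)"
    and rep: "[x = x' + t] (mod int p)" "[y = y' + t] (mod int p)" "[z = z' + t] (mod int p)"
    and t: "\<not> int p dvd t"
  shows False
proof -
  define R where "R = residue_ring (int p)"
  interpret residues_prime p R
    by (rule residues_prime.intro) (use assms R_def in auto)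
  have p: "p > 1" using prime_gt_1_nat[OF assms(1)] .
  have k: "k > 0" "k dvd p - 1" using circ by (auto simp: circular_def Let_def)
  let ?U = "unity_roots p k"
  let ?e = "t mod int p"
  have e: "?e \<in> carrier R" "?e \<noteq> 0"
    using p t by (auto simp: res_carrier_eq dvd_eq_mod_eq_0)
  have one: "1 \<in> Units R" using p by (simp add: res_prime_units_eq)
  have zero: "0 \<in> carrier R" using p by (simp add: res_carrier_eq)
  have r_coset: "?U #>\<^bsub>R\<^esub> 1 = ?U"
  proof -
    have "(\<lambda>h. h * 1 mod int p) ` ?U = (\<lambda>h. h) ` ?U"
      by (intro image_cong) (auto simp: unity_roots_def)
    thus ?thesis by (simp add: r_coset_def res_mult_eq) blast
  qed
  have translate: "A +>\<^bsub>R\<^esub> b = (\<lambda>h. (h + b) mod int p) ` A" for A b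
    by (auto simp: a_r_coset_def r_coset_def res_add_eq)
  have "card ((?U +>\<^bsub>R\<^esub> 0) \<inter> (?U +>\<^bsub>R\<^esub> ?e)) \<le> 2"
  proof -
    \<comment> \<open>Both cosets are taken with multiplier 1, so the sets are told apart by the
      translations 0 and \<open>?e\<close> alone.\<close>
    have "card (((?U #>\<^bsub>R\<^esub> 1) +>\<^bsub>R\<^esub> 0) \<inter> ((?U #>\<^bsub>R\<^esub> 1) +>\<^bsub>R\<^esub> ?e)) \<le> 2"
      using circ subgroup_unity_roots[OF assms(1) k(1)] card_unity_roots[OF assms(1) k] e one zero
      unfolding circular_def Let_def R_def[symmetric] by metis
    thus ?thesis by (simp add: r_coset)
  qed
  moreover have mem: "u mod int p \<in> (?U +>\<^bsub>R\<^esub> 0) \<inter> (?U +>\<^bsub>R\<^esub> ?e)"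
    if "[u ^ k = 1] (mod int p)" "[u' ^ k = 1] (mod int p)" "[u = u' + t] (mod int p)" for u u'
  proof -
    have "u mod int p \<in> ?U" "u' mod int p \<in> ?U" using that mod_mem_unity_roots assms(1) k by blast+
    moreover have "u mod int p = (u mod int p + 0) mod int p" by simp
    moreover have "u mod int p = (u' mod int p + ?e) mod int p"
      using that(3) by (simp add: cong_def mod_add_eq)
    ultimately show ?thesis unfolding translate by blast
  qed
  have "{x mod int p, y mod int p, z mod int p} \<subseteq> (?U +>\<^bsub>R\<^esub> 0) \<inter> (?U +>\<^bsub>R\<^esub> ?e)"
    using mem[OF roots(1,4) rep(1)] mem[OF roots(2,5) rep(2)] mem[OF roots(3,6) rep(3)] by auto
  moreover have "finite ((?U +>\<^bsub>R\<^esub> 0) \<inter> (?U +>\<^bsub>R\<^esub> ?e))" by (simp add: translate)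
  ultimately have "card {x mod int p, y mod int p, z mod int p} \<le> 2"
    by (meson card_mono le_trans)
  moreover have "card {x mod int p, y mod int p, z mod int p} = 3"
    using differ by (simp add: cong_def)
  ultimately show False by simp
qed

text \<open>The congruence says c - e = a - b; in this form its two sides give the exponent (a + e)
  - (c + b) of the expanded fourth power.\<close>

definition difference_reps :: "nat \<Rightarrow> nat \<Rightarrow> int \<Rightarrow> int \<Rightarrow> (int \<times> int) set" where
  "difference_reps p k a b =
    {(c, e) \<in> unity_roots p k \<times> unity_roots p k. [a + e = c + b] (mod int p)}"

lemma finite_difference_reps [simp]: "finite (difference_reps p k a b)"
  by (rule finite_subset[of _ "unity_roots p k \<times> unity_roots p k"])
    (auto simp: difference_reps_def)

lemma self_mem_difference_reps:
  "a \<in> unity_roots p k \<Longrightarrow> b \<in> unity_roots p k \<Longrightarrow> (a, b) \<in> difference_reps p k a b"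
  by (simp add: difference_reps_def)

text \<open>A representation is determined by its first component, so distinct representations yield
  distinct points of the intersection of the group with its translate.\<close>

lemma difference_reps_eqI:
  assumes "(c, e) \<in> difference_reps p k a b" "(c', e') \<in> difference_reps p k a b"
    and "[c = c'] (mod int p)"
  shows "(c, e) = (c', e')"
proof -
  have "c = c'" using assms by (intro cong_unity_roots_eq[of _ p k]) (auto simp: difference_reps_def)
  moreover have "[a + e = a + e'] (mod int p)"
    using assms \<open>c = c'\<close> unfolding difference_reps_def by (auto simp: cong_def)
  hence "[e = e'] (mod int p)" using cong_add_lcancel by blast
  hence "e = e'" using assms by (intro cong_unity_roots_eq[of _ p k]) (auto simp: difference_reps_def)
  ultimately show ?thesis by simp
qed

lemma card_difference_reps_diagonal:
  assumes "a \<in> unity_roots p k"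
  shows "card (difference_reps p k a a) = card (unity_roots p k)"
proof -
  have "difference_reps p k a a = (\<lambda>c. (c, c)) ` unity_roots p k"
  proof -
    have "c = e" if "c \<in> unity_roots p k" "e \<in> unity_roots p k" "[a + e = c + a] (mod int p)" for c e
      using that by (metis add.commute cong_add_lcancel cong_sym cong_unity_roots_eq)
    thus ?thesis by (auto simp: difference_reps_def add.commute)
  qed
  thus ?thesis by (simp add: card_image inj_on_def)
qed

lemma difference_not_dvd:
  assumes "a \<in> unity_roots p k" "b \<in> unity_roots p k" "a \<noteq> b"
  shows "\<not> int p dvd a - b"
  using assms cong_unity_roots_eq by (metis cong_iff_dvd_diff)

lemma cong_double_cancel:
  assumes "prime p" "odd p" "[2 * x = 2 * y] (mod int p)"
  shows "[x = y] (mod int p)"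
proof -
  have "coprime 2 (int p)" using assms(2) by simp
  thus ?thesis using assms(3) cong_mult_lcancel by blast
qed

text \<open>All of a, c, -b lie in the group of 2k-th roots, and a = b + t, c = e + t, -b = -a + t
  for t = a - b. A second representation (c, e) would make them three distinct common
  points.\<close>

lemma card_difference_reps_odd:
  assumes p: "prime p" "odd p" and k: "odd k" and circ: "circular p (2 * k)"
    and a: "a \<in> unity_roots p k" and b: "b \<in> unity_roots p k" and "a \<noteq> b"
  shows "card (difference_reps p k a b) = 1"
proof -
  have roots: "[x ^ (2 * k) = 1] (mod int p)" "[(- x) ^ (2 * k) = 1] (mod int p)"
    if "x \<in> unity_roots p k" for x
  proof -
    have "[(x ^ k) ^ 2 = 1 ^ 2] (mod int p)" using that by (intro cong_pow) (simp add: unity_roots_def)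
    thus "[x ^ (2 * k) = 1] (mod int p)" by (simp add: power_mult[symmetric] mult.commute)
    thus "[(- x) ^ (2 * k) = 1] (mod int p)" by simp
  qed
  \<comment> \<open>For odd k, raising x = -y to the k-th power gives 1 = -1, impossible for odd
    p.\<close>
  have neg: "\<not> [x = - y] (mod int p)" if "x \<in> unity_roots p k" "y \<in> unity_roots p k" for x y
  proof
    assume "[x = - y] (mod int p)"
    hence "[x ^ k = (- y) ^ k] (mod int p)" by (rule cong_pow)
    hence "[x ^ k = - (y ^ k)] (mod int p)" using k by simp
    moreover have "[- (y ^ k) = - 1] (mod int p)"
      using that(2) by (simp add: unity_roots_def cong_minus_minus_iff)
    moreover have "[x ^ k = 1] (mod int p)" using that(1) by (simp add: unity_roots_def)
    ultimately have "[1 = - 1] (mod int p)" using cong_trans cong_sym by blast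
    hence "int p dvd 2" by (simp add: cong_iff_dvd_diff)
    hence "p dvd 2" by presburger
    thus False using p by (metis primes_dvd_imp_eq two_is_prime_nat)
  qed
  have "(c, e) = (a, b)" if ce: "(c, e) \<in> difference_reps p k a b" for c e
  proof (rule ccontr)
    assume ne: "(c, e) \<noteq> (a, b)"
    have c: "c \<in> unity_roots p k" and e: "e \<in> unity_roots p k" and rep: "[a + e = c + b] (mod int p)"
      using ce by (auto simp: difference_reps_def)
    have "\<not> [c = a] (mod int p)"
      using difference_reps_eqI[OF ce self_mem_difference_reps[OF a b]] ne by blast
    show False
    proof (rule circular_no_three_representations[OF p(1) circ, of a c "- b" b e "- a" "a - b"])
      show "\<not> [a = c] (mod int p)" using \<open>\<not> [c = a] (mod int p)\<close> cong_sym by blast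
      have "[c = e + (a - b)] (mod int p) \<longleftrightarrow> [a + e = c + b] (mod int p)"
        by (simp add: cong_iff_dvd_diff dvd_diff_commute algebra_simps)
      thus "[c = e + (a - b)] (mod int p)" using rep by simp
    qed (use roots neg a b c e difference_not_dvd[OF a b \<open>a \<noteq> b\<close>] in auto)
  qed
  hence "difference_reps p k a b = {(a, b)}" using self_mem_difference_reps[OF a b] by auto
  thus ?thesis by simp
qed

text \<open>The representations (a, b) and (-b, -a) coincide exactly when b = -a. If they differ, a
  third one contradicts circularity directly; if they coincide, any other (c, e) brings its mirror
  image (-e, -c), again giving three points.\<close>

lemma card_difference_reps_even:
  assumes p: "prime p" "odd p" and k: "even k" and circ: "circular p k"
    and a: "a \<in> unity_roots p k" and b: "b \<in> unity_roots p k" and "a \<noteq> b"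
  shows "card (difference_reps p k a b) = (if [b = - a] (mod int p) then 1 else 2)"
proof -
  have kpos: "k > 0" using circ by (simp add: circular_def)
  have roots: "[x ^ k = 1] (mod int p)" "[(- x) ^ k = 1] (mod int p)"
    if "x \<in> unity_roots p k" for x
    using that k by (simp_all add: unity_roots_def)
  have t: "\<not> int p dvd a - b" using difference_not_dvd[OF a b \<open>a \<noteq> b\<close>] .
  have rep_iff: "[c = e + (a - b)] (mod int p) \<longleftrightarrow> [a + e = c + b] (mod int p)" for c e
    by (simp add: cong_iff_dvd_diff dvd_diff_commute algebra_simps)
  have ab: "(a, b) \<in> difference_reps p k a b" using self_mem_difference_reps[OF a b] .
  show ?thesis
  proof (cases "[b = - a] (mod int p)")
    case True
    have "(c, e) = (a, b)" if ce: "(c, e) \<in> difference_reps p k a b" for c e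
    proof (rule ccontr)
      assume ne: "(c, e) \<noteq> (a, b)"
      have c: "c \<in> unity_roots p k" and e: "e \<in> unity_roots p k"
        and rep: "[a + e = c + b] (mod int p)"
        using ce by (auto simp: difference_reps_def)
      have ca: "\<not> [c = a] (mod int p)"
        using difference_reps_eqI[OF ce ab] ne by blast
      show False
      proof (rule circular_no_three_representations[OF p(1) circ, of a c "- e" b e "- c" "a - b"])
        show "\<not> [a = c] (mod int p)" using ca cong_sym by blast
        \<comment> \<open>With b = -a, the assumption e = -a turns a + e = c + b into c = a.\<close>
        show "\<not> [a = - e] (mod int p)"
        proof
          assume "[a = - e] (mod int p)"
          hence "int p dvd (a + e)" by (simp add: cong_iff_dvd_diff)
          moreover have "int p dvd (a + e) - (c + b)" using rep by (simp add: cong_iff_dvd_diff)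
          moreover have "int p dvd (b + a)" using True by (simp add: cong_iff_dvd_diff)
          ultimately have "int p dvd ((a + e) - (c + b)) - (a + e) + (b + a)"
            by (simp only: dvd_add dvd_diff)
          hence "int p dvd a - c" by (simp add: algebra_simps)
          thus False using ca by (simp add: cong_iff_dvd_diff dvd_diff_commute)
        qed
        \<comment> \<open>With b = -a and e = -c, the relation a + e = c + b becomes 2a = 2c, and 2
          is invertible modulo p.\<close>
        show "\<not> [c = - e] (mod int p)"
        proof
          assume "[c = - e] (mod int p)"
          hence "int p dvd (c + e)" by (simp add: cong_iff_dvd_diff)
          moreover have "int p dvd (a + e) - (c + b)" using rep by (simp add: cong_iff_dvd_diff)
          moreover have "int p dvd (b + a)" using True by (simp add: cong_iff_dvd_diff)
          ultimately have "int p dvd (c + e) - ((a + e) - (c + b)) - (b + a)"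
            by (simp only: dvd_diff)
          hence "[2 * c = 2 * a] (mod int p)" by (simp add: cong_iff_dvd_diff algebra_simps)
          thus False using cong_double_cancel[OF p] ca by blast
        qed
        show "[c = e + (a - b)] (mod int p)" using rep rep_iff by simp
        show "[- e = - c + (a - b)] (mod int p)"
          using rep by (simp add: cong_iff_dvd_diff dvd_diff_commute algebra_simps)
      qed (use roots a b c e t in auto)
    qed
    hence "difference_reps p k a b = {(a, b)}" using ab by auto
    thus ?thesis using True by simp
  next
    case False
    let ?a = "- a mod int p" and ?b = "- b mod int p"
    have neg: "?a \<in> unity_roots p k" "?b \<in> unity_roots p k"
      using mod_mem_unity_roots[OF p(1) kpos] roots a b by auto
    have "[a + ?a = ?b + b] (mod int p)"
      by (simp add: cong_def mod_add_left_eq mod_add_right_eq)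
    hence ba: "(?b, ?a) \<in> difference_reps p k a b" using neg by (simp add: difference_reps_def)
    have ab_neg: "\<not> [a = - b] (mod int p)"
      using False by (simp add: cong_iff_dvd_diff add.commute)
    have "(c, e) = (a, b) \<or> (c, e) = (?b, ?a)" if ce: "(c, e) \<in> difference_reps p k a b" for c e
    proof (rule ccontr)
      assume ne: "\<not> ((c, e) = (a, b) \<or> (c, e) = (?b, ?a))"
      have c: "c \<in> unity_roots p k" and e: "e \<in> unity_roots p k"
        and rep: "[a + e = c + b] (mod int p)"
        using ce by (auto simp: difference_reps_def)
      show False
      \<comment> \<open>The third point is -b = -a + (a - b), the first component of the mirrored
        representation.\<close>
      proof (rule circular_no_three_representations[OF p(1) circ, of a c "- b" b e "- a" "a - b"])
        show "\<not> [a = c] (mod int p)" using difference_reps_eqI[OF ab ce] ne by auto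
        show "\<not> [c = - b] (mod int p)"
          using difference_reps_eqI[OF ce ba] ne by (auto simp: cong_def)
        show "[c = e + (a - b)] (mod int p)" using rep rep_iff by simp
      qed (use roots ab_neg a b c e t in auto)
    qed
    hence "difference_reps p k a b = {(a, b), (?b, ?a)}" using ab ba by auto
    moreover have "(a, b) \<noteq> (?b, ?a)" using ab_neg by (auto simp: cong_def)
    ultimately show ?thesis using False by simp
  qed
qed

section \<open>Additive energy of the group of roots\<close>

definition energy :: "nat \<Rightarrow> nat \<Rightarrow> nat" where
  "energy p k = (\<Sum>a\<in>unity_roots p k. \<Sum>b\<in>unity_roots p k. card (difference_reps p k a b))"

lemma energy_odd:
  assumes "prime p" "odd p" "odd k" "k dvd p - 1" "circular p (2 * k)"
  shows "real (energy p k) = real k * (2 * real k - 1)"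
proof -
  let ?U = "unity_roots p k"
  have k: "k > 0" using assms(3) by (cases k) auto
  have card: "card ?U = k" using card_unity_roots[OF assms(1) k assms(4)] .
  \<comment> \<open>The diagonal term b = a contributes k, each of the other k - 1 roots contributes
    1.\<close>
  have "(\<Sum>b\<in>?U. card (difference_reps p k a b)) = k + (k - 1)" if a: "a \<in> ?U" for a
  proof -
    have "(\<Sum>b\<in>?U - {a}. card (difference_reps p k a b)) = (\<Sum>b\<in>?U - {a}. 1)"
      using a by (intro sum.cong refl card_difference_reps_odd assms) auto
    also have "\<dots> = k - 1" using a card by simp
    finally show ?thesis
      using a card by (simp add: sum.remove[of ?U a] card_difference_reps_diagonal)
  qed
  hence "energy p k = k * (k + (k - 1))" using card by (simp add: energy_def)
  thus ?thesis using k by simp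
qed

lemma energy_even:
  assumes "prime p" "odd p" "even k" "k dvd p - 1" "circular p k"
  shows "real (energy p k) = 3 * real k * (real k - 1)"
proof -
  let ?U = "unity_roots p k"
  have k: "k > 0" using assms(5) by (simp add: circular_def)
  have card: "card ?U = k" using card_unity_roots[OF assms(1) k assms(4)] .
  have "k \<ge> 2" using k assms(3) by (cases "k = 1") auto
  \<comment> \<open>The contributions are k from b = a, 1 from b = -a, and 2 from each remaining
    root. The bound k >= 2 keeps the natural subtraction exact.\<close>
  have "(\<Sum>b\<in>?U. card (difference_reps p k a b)) = k + (1 + 2 * (k - 2))" if a: "a \<in> ?U" for a
  proof -
    let ?a = "- a mod int p"
    have neg: "?a \<in> ?U"
      using a assms(3) by (intro mod_mem_unity_roots assms k) (simp add: unity_roots_def)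
    have "?a \<noteq> a"
    proof
      assume "?a = a"
      hence "[a = - a] (mod int p)" by (metis cong_def mod_mod_trivial)
      hence "[2 * a = 2 * 0] (mod int p)" by (simp add: cong_iff_dvd_diff)
      hence "[a = 0] (mod int p)" using cong_double_cancel[OF assms(1,2)] by blast
      thus False using a by (auto simp: unity_roots_def cong_def)
    qed
    have val: "card (difference_reps p k a b) = (if [b = - a] (mod int p) then 1 else 2)"
      if "b \<in> ?U" "b \<noteq> a" for b
      using card_difference_reps_even[OF assms(1,2,3,5) a that(1)] that(2) by auto
    have one: "card (difference_reps p k a ?a) = 1"
      using val[OF neg \<open>?a \<noteq> a\<close>] by (simp add: cong_def)
    have "(\<Sum>b\<in>?U - {a} - {?a}. card (difference_reps p k a b)) = (\<Sum>b\<in>?U - {a} - {?a}. 2)"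
    proof (intro sum.cong refl)
      fix b assume b: "b \<in> ?U - {a} - {?a}"
      have "\<not> [b = - a] (mod int p)"
      proof
        assume "[b = - a] (mod int p)"
        hence "b = ?a" using b neg by (intro cong_unity_roots_eq[of _ p k]) (auto simp: cong_def)
        thus False using b by simp
      qed
      thus "card (difference_reps p k a b) = 2" using val b by simp
    qed
    also have "\<dots> = 2 * (k - 2)"
      using a neg \<open>?a \<noteq> a\<close> card by simp
    finally show ?thesis
      using a card neg \<open>?a \<noteq> a\<close> one
      by (simp add: sum.remove[of ?U a] sum.remove[of "?U - {a}" ?a] card_difference_reps_diagonal)
  qed
  hence "energy p k = k * (k + (1 + 2 * (k - 2)))" using card by (simp add: energy_def)
  thus ?thesis using \<open>k \<ge> 2\<close> by (simp add: algebra_simps)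
qed

section \<open>Additive characters modulo p and their orthogonality\<close>

lemma e_p_conv_cis: "e_p p x = cis (2 * pi * real_of_int x / real p)"
  by (simp add: e_p_def cis_conv_exp mult_ac)

lemma e_p_add: "e_p p (x + y) = e_p p x * e_p p y"
  by (simp add: e_p_def exp_add[symmetric] add_divide_distrib algebra_simps)

lemma e_p_0 [simp]: "e_p p 0 = 1"
  by (simp add: e_p_def)

lemma cnj_e_p: "cnj (e_p p x) = e_p p (- x)"
  by (simp add: e_p_conv_cis cis_cnj)

lemma e_p_mult_nat: "e_p p (int n * x) = e_p p x ^ n"
  by (induction n) (simp_all add: e_p_add distrib_right)

lemma e_p_eq_1_iff:
  assumes "p > 0"
  shows "e_p p x = 1 \<longleftrightarrow> int p dvd x"
proof -
  \<comment> \<open>On the unit circle, real part 1 forces imaginary part 0.\<close>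
  have "e_p p x = 1 \<longleftrightarrow> cos (2 * pi * real_of_int x / real p) = 1"
    using cos_one_sin_zero by (auto simp: e_p_conv_cis complex_eq_iff)
  also have "\<dots> \<longleftrightarrow> (\<exists>n::int. 2 * pi * real_of_int x / real p = real_of_int n * 2 * pi)"
    by (rule cos_one_2pi_int)
  also have "\<dots> \<longleftrightarrow> (\<exists>n::int. x = int p * n)"
  proof (rule ex_cong1)
    fix n :: int
    have "2 * pi * real_of_int x / real p = real_of_int n * 2 * pi \<longleftrightarrow>
        real_of_int x = real_of_int (int p * n)"
      using assms by (auto simp: field_simps)
    thus "2 * pi * real_of_int x / real p = real_of_int n * 2 * pi \<longleftrightarrow> x = int p * n"
      by linarith
  qed
  finally show ?thesis by (simp add: dvd_def)
qed

lemma e_p_cong: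
  assumes "[x = y] (mod int p)" "p > 0"
  shows "e_p p x = e_p p y"
proof -
  have "e_p p (x - y) = 1" using assms by (simp add: e_p_eq_1_iff cong_iff_dvd_diff)
  thus ?thesis using e_p_add[of p "x - y" y] by simp
qed

text \<open>This is a geometric sum whose ratio \<open>e_p p t\<close> is a p-th root of unity; it
  vanishes unless the ratio is 1.\<close>

lemma sum_e_p:
  assumes "p > 0"
  shows "(\<Sum>x\<in>{0..<int p}. e_p p (x * t)) = (if int p dvd t then of_nat p else 0)"
proof -
  have "(\<Sum>x\<in>{0..<int p}. e_p p (x * t)) = (\<Sum>n<p. e_p p t ^ n)"
    unfolding e_p_mult_nat[symmetric]
    by (rule sum.reindex_bij_witness[of _ int nat]) auto
  also have "\<dots> = (if int p dvd t then of_nat p else 0)"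
  proof (cases "int p dvd t")
    case True
    thus ?thesis using assms by (simp add: e_p_eq_1_iff[THEN iffD2])
  next
    case False
    hence "e_p p t \<noteq> 1" using assms by (simp add: e_p_eq_1_iff)
    moreover have "e_p p t ^ p = 1"
      using assms by (simp add: e_p_mult_nat[symmetric] e_p_eq_1_iff)
    ultimately show ?thesis using False by (simp add: geometric_sum)
  qed
  finally show ?thesis .
qed

section \<open>Gaussian periods and their fourth moment over all residues\<close>

definition period :: "nat \<Rightarrow> nat \<Rightarrow> int \<Rightarrow> complex" where
  "period p k x = (\<Sum>a\<in>unity_roots p k. e_p p (x * a))"

lemma period_mod:
  assumes "p > 0"
  shows "period p k (x mod int p) = period p k x"
  unfolding period_def using assms
  by (intro sum.cong refl e_p_cong) (auto simp: cong_def mod_mult_left_eq)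

lemma norm_period_pow4:
  "complex_of_real (cmod (period p k x) ^ 4) =
    (\<Sum>a\<in>unity_roots p k. \<Sum>b\<in>unity_roots p k. \<Sum>(c, e)\<in>unity_roots p k \<times> unity_roots p k.
      e_p p (x * ((a + e) - (c + b))))"
proof -
  let ?U = "unity_roots p k" and ?S = "period p k x"
  have "complex_of_real (cmod ?S ^ 4) = complex_of_real (cmod ?S ^ 2) * complex_of_real (cmod ?S ^ 2)"
    by (simp flip: of_real_mult power_add)
  \<comment> \<open>The order of conjugation gives b and c negative sign and a and e positive sign,
    as in \<open>difference_reps\<close>.\<close>
  also have "\<dots> = (?S * cnj ?S) * (cnj ?S * ?S)"
    by (simp only: complex_norm_square mult.commute[of "cnj ?S"])
  also have "\<dots> = (\<Sum>a\<in>?U. \<Sum>b\<in>?U. e_p p (x * a) * e_p p (- (x * b))) *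
      (\<Sum>(c, e)\<in>?U \<times> ?U. e_p p (- (x * c)) * e_p p (x * e))"
    by (simp add: period_def cnj_e_p sum_product sum.cartesian_product)
  also have "\<dots> = (\<Sum>a\<in>?U. \<Sum>b\<in>?U. \<Sum>(c, e)\<in>?U \<times> ?U.
      (e_p p (x * a) * e_p p (- (x * b))) * (e_p p (- (x * c)) * e_p p (x * e)))"
    by (simp only: sum_distrib_right) (simp only: sum_distrib_left case_prod_unfold)
  also have "\<dots> = (\<Sum>a\<in>?U. \<Sum>b\<in>?U. \<Sum>(c, e)\<in>?U \<times> ?U. e_p p (x * ((a + e) - (c + b))))"
    unfolding e_p_add[symmetric] by (simp add: algebra_simps)
  finally show ?thesis .
qed

text \<open>With the sum over x moved innermost, orthogonality leaves a factor p for each quadruple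
  with a + e = c + b modulo p and 0 for every other.\<close>

lemma sum_norm_period_pow4:
  assumes "p > 0"
  shows "(\<Sum>x\<in>{0..<int p}. cmod (period p k x) ^ 4) = real p * real (energy p k)"
proof -
  let ?U = "unity_roots p k"
  have inner: "(\<Sum>(c, e)\<in>?U \<times> ?U. \<Sum>x\<in>{0..<int p}. e_p p (x * ((a + e) - (c + b)))) =
      of_nat p * of_nat (card (difference_reps p k a b))" for a b
  proof -
    have "difference_reps p k a b = {q \<in> ?U \<times> ?U. int p dvd (a + snd q) - (fst q + b)}"
      by (auto simp: difference_reps_def cong_iff_dvd_diff)
    hence "(\<Sum>q\<in>?U \<times> ?U. if int p dvd (a + snd q) - (fst q + b) then complex_of_nat p else 0) =
        (\<Sum>q\<in>difference_reps p k a b. of_nat p)"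
      by (simp only: sum.inter_filter[symmetric] finite_cartesian_product finite_unity_roots)
    thus ?thesis using assms by (simp add: sum_e_p case_prod_unfold)
  qed
  have "complex_of_real (\<Sum>x\<in>{0..<int p}. cmod (period p k x) ^ 4) =
      (\<Sum>x\<in>{0..<int p}. \<Sum>a\<in>?U. \<Sum>b\<in>?U. \<Sum>(c, e)\<in>?U \<times> ?U. e_p p (x * ((a + e) - (c + b))))"
    unfolding of_real_sum norm_period_pow4 ..
  also have "\<dots> = (\<Sum>a\<in>?U. \<Sum>b\<in>?U. \<Sum>(c, e)\<in>?U \<times> ?U. \<Sum>x\<in>{0..<int p}.
      e_p p (x * ((a + e) - (c + b))))"
    unfolding case_prod_unfold sum.swap[of _ _ "{0..<int p}"] ..
  also have "\<dots> = complex_of_real (real p * real (energy p k))"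
    by (simp only: inner) (simp add: energy_def sum_distrib_left)
  finally show ?thesis by (simp only: of_real_eq_iff)
qed

section \<open>Passing from all residues to the d periods in \<open>V4\<close>\<close>

text \<open>Multiplication by the root u permutes the group, so the period is constant on its
  cosets.\<close>

lemma period_mult_root:
  assumes "prime p" "k > 0" "[u ^ k = 1] (mod int p)"
  shows "period p k (x * u) = period p k x"
proof -
  let ?U = "unity_roots p k"
  let ?f = "\<lambda>a. u * a mod int p"
  have p: "p > 0" using assms(1) prime_gt_0_nat by blast
  have cop: "coprime u (int p)"
  proof -
    have "coprime (u ^ k) (int p)"
      by (rule cong_imp_coprime[OF cong_sym[OF assms(3)]]) simp
    thus ?thesis using assms(2) by simp
  qed
  have "?f ` ?U \<subseteq> ?U"
  proof clarify
    fix a assume "a \<in> ?U"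
    hence "[(u * a) ^ k = 1 * 1] (mod int p)"
      unfolding power_mult_distrib using assms by (intro cong_mult) (auto simp: unity_roots_def)
    thus "?f a \<in> ?U" by (intro mod_mem_unity_roots assms) simp
  qed
  moreover have inj: "inj_on ?f ?U"
  proof (rule inj_onI)
    fix a b assume "a \<in> ?U" "b \<in> ?U" "?f a = ?f b"
    thus "a = b" using cop cong_mult_lcancel cong_unity_roots_eq by (metis cong_def)
  qed
  ultimately have "?f ` ?U = ?U" by (intro endo_inj_surj) auto
  hence "period p k x = (\<Sum>a\<in>?f ` ?U. e_p p (x * a))" by (simp add: period_def)
  also have "\<dots> = (\<Sum>a\<in>?U. e_p p (x * ?f a))" using inj by (simp add: sum.reindex)
  also have "\<dots> = period p k (x * u)"
    unfolding period_def using p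
    by (intro sum.cong refl e_p_cong) (auto simp: cong_def mod_mult_right_eq mult.assoc)
  finally show ?thesis ..
qed

lemma eta_eq_period:
  assumes "prime p" "residue_primroot p g" "k > 0" "k dvd p - 1"
  shows "eta p g k s = period p k (int g ^ s)"
proof -
  have p: "p > 0" using assms(1) prime_gt_0_nat by blast
  define d where "d = (p - 1) div k"
  have "p - 1 = d * k" using assms(4) by (simp add: d_def)
  note bij = unity_roots_bij[OF assms(1-3) this]
  have "period p k (int g ^ s) = (\<Sum>j<k. e_p p (int g ^ s * (int g ^ (d * j) mod int p)))"
    unfolding period_def by (rule sum.reindex_bij_betw[OF bij, symmetric])
  also have "\<dots> = (\<Sum>j<k. e_p p (int g ^ (d * j + s)))"
    using p by (intro sum.cong refl e_p_cong)
      (auto simp: cong_def mod_mult_right_eq power_add mult.commute)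
  finally show ?thesis by (simp add: eta_def Let_def d_def)
qed

text \<open>In the moment over all residues, x = 0 contributes k^4, and the nonzero residues, split
  into d cosets of size k, contribute k times \<open>V4\<close>.\<close>

lemma V4_eq_energy:
  assumes "prime p" "residue_primroot p g" "k > 0" "k dvd p - 1"
  shows "real k * V4 p g k = real p * real (energy p k) - real k ^ 4"
proof -
  have p: "p > 1" using assms(1) prime_gt_1_nat by blast
  define d where "d = (p - 1) div k"
  have dk: "p - 1 = k * d" using assms(4) by (simp add: d_def)
  define h where "h n = cmod (period p k (int g ^ n)) ^ 4" for n :: nat
  \<comment> \<open>As p - 1 = k d, the factor g^(i d) is a k-th root of unity, so \<open>h\<close>
    has period d.\<close>
  have h_shift: "h (s + i * d) = h s" for s i
  proof -
    have "[(int g ^ (i * d)) ^ k = 1] (mod int p)"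
      using primroot_power_cong_1_iff[OF assms(1,2)] dk by (simp add: power_mult[symmetric] mult_ac)
    thus ?thesis using period_mult_root[OF assms(1,3)] by (simp add: h_def power_add)
  qed
  have "(\<Sum>x\<in>{1..<int p}. cmod (period p k x) ^ 4) =
      (\<Sum>n<p - 1. cmod (period p k (int g ^ n mod int p)) ^ 4)"
    by (rule sum.reindex_bij_betw[OF primroot_power_mod_bij[OF assms(1,2)], symmetric])
  also have "\<dots> = (\<Sum>n<k * d. h n)"
    using p by (simp only: h_def dk) (simp add: period_mod)
  \<comment> \<open>The exponents below k d are cut into k blocks of length d, each running through
    one full period of \<open>h\<close>.\<close>
  also have "\<dots> = (\<Sum>i<k. \<Sum>n\<in>{i * d..<i * d + d}. h n)" by (rule sum.nat_group[symmetric])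
  also have "\<dots> = (\<Sum>i<k. \<Sum>s<d. h s)"
  proof (rule sum.cong[OF refl])
    fix i
    have "(\<Sum>n\<in>{i * d..<i * d + d}. h n) = (\<Sum>s<d. h (s + i * d))"
      by (rule sum.reindex_bij_witness[of _ "\<lambda>s. s + i * d" "\<lambda>n. n - i * d"]) auto
    thus "(\<Sum>n\<in>{i * d..<i * d + d}. h n) = (\<Sum>s<d. h s)" by (simp add: h_shift)
  qed
  also have "\<dots> = real k * V4 p g k"
    by (simp add: V4_def Let_def d_def h_def eta_eq_period[OF assms])
  finally have nonzero: "(\<Sum>x\<in>{1..<int p}. cmod (period p k x) ^ 4) = real k * V4 p g k" .
  have "{0..<int p} = insert 0 {1..<int p}" using p by auto
  hence "(\<Sum>x\<in>{0..<int p}. cmod (period p k x) ^ 4) = cmod (period p k 0) ^ 4 + real k * V4 p g k"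
    by (simp add: nonzero)
  moreover have "period p k 0 = of_nat k"
    by (simp add: period_def card_unity_roots[OF assms(1,3,4)])
  ultimately show ?thesis using sum_norm_period_pow4[of p k] p by simp
qed

theorem theorem5p6:
  fixes p g k :: nat
  assumes "prime p" and "odd p"
    and "residue_primroot p g"
    and "k > 0" and "k dvd p - 1"
    and "circular p k"
  shows "(even k \<longrightarrow> V4 p g k = 3 * real p * (real k - 1) - real k ^ 3) \<and>
         (odd k \<and> circular p (2 * k) \<longrightarrow> V4 p g k = real p * (2 * real k - 1) - real k ^ 3)"
proof -
  \<comment> \<open>The energy carries a factor k in both cases; cancelling it in
    \<open>V4_eq_energy\<close> turns k^4 into k^3.\<close>
  have V4: "V4 p g k = real p * c - real k ^ 3" if "real (energy p k) = real k * c" for c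
  proof -
    have "real k * V4 p g k = real k * (real p * c - real k ^ 3)"
      using V4_eq_energy[OF assms(1,3,4,5)] that
      by (simp add: algebra_simps power4_eq_xxxx power3_eq_cube)
    thus ?thesis using assms(4) by simp
  qed
  show ?thesis
    using V4[of "3 * (real k - 1)"] V4[of "2 * real k - 1"]
      energy_even[OF assms(1,2) _ assms(5,6)] energy_odd[OF assms(1,2) _ assms(5)]
    by (simp add: mult_ac)
qed

end
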